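(* All parameters below are fixed complex numbers and $z\in\mathbb{C}$ is fixed. (1) Let $p,q,r,s$ be nonnegative integers satisfying $q\geqslant p+1$ and $s\geqslant r-1$. Define $$\mathcal{F}_n^{(1)}(z):={}_{p+r}F_{q+s}\biggl[\begin{matrix}a_1-n,\dots,a_p-n,b_1,\dots,b_r\\ c_1-n,\dots,c_q-n,d_1,\dots,d_s\end{matrix};z\biggr]$$ and assume that $c_1,\dots,c_q\notin\mathbb{Z}$ and $d_1,\dots,d_s\notin\mathbb{Z}_{\leqslant0}$. Then for any positive integer $N$, $$\mathcal{F}_n^{(1)}(z)=\sum_{k=0}^{N-1}\frac{(a_1-n)_k\cdots(a_p-n)_k}{(c_1-n)_k\cdots(c_q-n)_k}\frac{(b_1)_k\cdots(b_r)_k}{(d_1)_k\cdots(d_s)_k}\frac{z^k}{k!}+\mathcal{O}\bigl(n^{(p-q)N}\bigr)$$ as $n\to+\infty$ through integer values. (2) Let $p$ be a nonnegative integer. Define $$\mathcal{F}_n^{(2)}(z):={}_{p+1}F_{p+1}\biggl[\begin{matrix}a_1,\dots,a_p,b-n\\ c_1,\dots,c_p,d-n\end{matrix};z\biggr]$$ and assume that $c_1,\dots,c_p\notin\mathbb{Z}_{\leqslant0}$ and $b,d\notin\mathbb{Z}$. Then for any positive integer $N$, $$\mathcal{F}_n^{(2)}(z)=\sum_{k=0}^{N-1}\frac{(a_1)_k\cdots(a_p)_k}{(c_1)_k\cdots(c_p)_k}\frac{(d-b)_k}{(d-n)_k}\frac{(-z)^k}{k!}\,{}_pF_p\biggl[\begin{matrix}a_1+k,\dots,a_p+k\\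 c_1+k,\dots,c_p+k\end{matrix};z\biggr]+\mathcal{O}\bigl(n^{-N}\bigr)$$ as $n\to+\infty$ through integer values.
   Context: $(\cdot)_k$ is the Pochhammer symbol and ${}_pF_q\bigl[\begin{smallmatrix}a_1,\dots,a_p\\ b_1,\dots,b_q\end{smallmatrix};z\bigr]=\sum_{n=0}^{\infty}\frac{(a_1)_n\cdots(a_p)_n}{(b_1)_n\cdots(b_q)_n}\frac{z^n}{n!}$ is the generalized hypergeometric function, with $a_j\in\mathbb{C}$ and $b_j\in\mathbb{C}\setminus\mathbb{Z}_{\leqslant0}$ (empty products equal $1$). *)

theory Defs
  imports "HOL-Analysis.Analysis" "HOL-Library.Landau_Symbols"
begin

text \<open>
  The generalized hypergeometric function with upper parameters \<open>as\<close> and lower parameters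
  \<open>bs\<close>; the orders are the lengths of the lists. The series is used only where it
  converges for every \<open>z\<close>, namely when no lower parameter is a nonpositive integer and
  \<open>length as \<le> length bs\<close>.
\<close>

definition hypergeom :: "complex list \<Rightarrow> complex list \<Rightarrow> complex \<Rightarrow> complex" where
  "hypergeom as bs z =
     (\<Sum>n. (\<Prod>a\<leftarrow>as. pochhammer a n) / (\<Prod>b\<leftarrow>bs. pochhammer b n) * (z ^ n / fact n))"

lemma foldl_mult_conv_prod_list:
  fixes f :: "'a \<Rightarrow> 'b :: comm_monoid_mult"
  shows "foldl (\<lambda>r x. r * f x) c xs = c * (\<Prod>x\<leftarrow>xs. f x)"
  by (induction xs arbitrary: c) (simp_all add: mult.assoc)

text \<open>Agreement with the library's formal hypergeometric series.\<close>

lemma hypergeom_conv_eval_fps: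
  "hypergeom as bs z = eval_fps (fps_hypergeo as bs 1) z"
  by (simp add: hypergeom_def eval_fps_def fps_hypergeo_def foldl_mult_conv_prod_list)

lemma hypergeom_0_0: "hypergeom [] [] z = exp z"
  by (simp add: hypergeom_def exp_def scaleR_conv_of_real field_simps)

end

theory Submission
  imports Defs
begin

text \<open>
  Both expansions come from bounding each term of a series, multiplied by the claimed power of
  \<open>n\<close>, by a summable sequence that is independent of \<open>n\<close>. The point to watch is that
  \<open>pochhammer (c - n) k\<close> passes close to zero once \<open>k\<close> exceeds \<open>n\<close>, so a termwise limit
  alone proves nothing about the tail.

  The bounds rest on comparing every factor with the integer lattice. If \<open>c\<close> is not an
  integer, then \<open>norm (c + i)\<close> lies between two positive multiples of \<open>1 + \<bar>i\<bar>\<close>, for all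
  integers \<open>i\<close> at once; the upper bound holds for every \<open>c\<close>. Hence, up to factors \<open>K ^ k\<close>,
  \<open>pochhammer (c - n) k\<close> has the size of the same model product
  \<open>weight n k = (\<Prod>j<k. 1 + \<bar>j - n\<bar>)\<close>, which for \<open>n = 0\<close> is \<open>fact k\<close>. Quotients of Pochhammer
  symbols become powers of weights, and a factor \<open>K ^ k\<close> is harmless against a factorial.
  What remains is elementary (\<open>power_div_weight_le\<close>): the first \<open>N\<close> factors of \<open>weight n k\<close>
  absorb \<open>n ^ N\<close> up to the constant \<open>fact N\<close>, and the other \<open>k - N\<close> factors, whatever \<open>n\<close> is,
  have a product of at least \<open>fact (k - N) / 2 ^ (k - N)\<close>.

  In the first expansion the remainder is the tail \<open>k \<ge> N\<close> of the defining series. The \<open>q - p\<close>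
  surplus lower parameters leave \<open>weight n k\<close> to the power \<open>p - q\<close>, and \<open>r \<le> s + 1\<close> makes
  the unshifted parameters together with \<open>1 / fact k\<close> contribute at most \<open>K ^ k\<close>.

  For the second expansion, the Chu-Vandermonde identity writes
  \<open>pochhammer (b - n) k / pochhammer (d - n) k\<close> as the sum over \<open>j \<le> k\<close> of
  \<open>(-1) ^ j * (k choose j) * pochhammer (d - b) j / pochhammer (d - n) j\<close>. Summing over \<open>k\<close>
  for each fixed \<open>j < N\<close> gives exactly the terms of the expansion, because
  \<open>k choose j\<close> restricts the sum to \<open>k \<ge> j\<close> and shifts all parameters by \<open>j\<close>. The part with
  \<open>N \<le> j \<le> k\<close> stays inside the sum over \<open>k\<close>, where it is at most a multiple of
  \<open>K ^ k * n powi (- N)\<close> by the same weight estimate; so only finitely many series are rearranged.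
\<close>

section \<open>The model product\<close>

definition weight :: "int \<Rightarrow> nat \<Rightarrow> real" where
  "weight m k = (\<Prod>j<k. 1 + \<bar>real j - real_of_int m\<bar>)"

lemma weight_Suc: "weight m (Suc k) = weight m k * (1 + \<bar>real k - real_of_int m\<bar>)"
  by (simp add: weight_def)

lemma weight_Suc_shift: "weight m (Suc k) = (1 + \<bar>real_of_int m\<bar>) * weight (m - 1) k"
  unfolding weight_def prod.lessThan_Suc_shift by (simp add: algebra_simps)

lemma weight_ge_1: "1 \<le> weight m k"
  unfolding weight_def by (rule prod_ge_1) auto

lemma weight_pos: "0 < weight m k"
  using weight_ge_1[of m k] by linarith

lemma weight_nonneg [simp]: "0 \<le> weight m k"
  using weight_pos[of m k] by linarith

lemma weight_0_eq_fact: "weight 0 k = fact k"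
  by (induction k) (simp_all add: weight_Suc, simp add: weight_def)

lemma weight_add: "weight m (N + i) = weight m N * weight (m - int N) i"
  by (induction i) (simp_all add: weight_Suc algebra_simps, simp add: weight_def)

text \<open>
  Among the points \<open>0, \<dots>, k\<close>, the end point farther from \<open>m\<close> is at distance at least \<open>k / 2\<close>.
  Splitting off that end point leaves a block of \<open>k\<close> consecutive points, to which the induction
  hypothesis applies, after a translation by one if the point is \<open>0\<close>. Hence the induction is
  over all \<open>m\<close> simultaneously.
\<close>

lemma fact_le_weight: "fact k \<le> 2 ^ k * weight m k"
proof (induction k arbitrary: m)
  case 0
  show ?case by (simp add: weight_def)
next
  case (Suc k)
  show ?case
  proof (cases "2 * m \<le> int k")
    case True
    then have "2 * real_of_int m \<le> real k" by linarith
    then have "real k + 1 \<le> 2 * (1 + \<bar>real k - real_of_int m\<bar>)"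
      using abs_ge_self[of "real k - real_of_int m"] by argo
    with Suc.IH[of m] have "fact k * (real k + 1) \<le> (2 ^ k * weight m k) * (2 * (1 + \<bar>real k - real_of_int m\<bar>))"
      by (intro mult_mono) auto
    then show ?thesis by (simp add: weight_Suc algebra_simps)
  next
    case False
    then have "real k \<le> 2 * real_of_int m" by linarith
    then have "real k + 1 \<le> 2 * (1 + \<bar>real_of_int m\<bar>)"
      using abs_ge_self[of "real_of_int m"] by argo
    with Suc.IH[of "m - 1"]
    have "fact k * (real k + 1) \<le> (2 ^ k * weight (m - 1) k) * (2 * (1 + \<bar>real_of_int m\<bar>))"
      by (intro mult_mono) auto
    then show ?thesis by (simp add: weight_Suc_shift algebra_simps)
  qed
qed

lemma power_le_fact_weight: "real n ^ N \<le> fact N * weight (int n) N"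
proof (induction N)
  case 0
  show ?case by (simp add: weight_def)
next
  case (Suc N)
  have "real n \<le> (1 + real N) * (1 + \<bar>real N - real n\<bar>)"
  proof -
    have "real n \<le> 1 + real N + \<bar>real N - real n\<bar>" by linarith
    also have "\<dots> \<le> 1 + real N + \<bar>real N - real n\<bar> + real N * \<bar>real N - real n\<bar>"
      by simp
    finally show ?thesis by (simp add: algebra_simps)
  qed
  with Suc have "real n ^ N * real n \<le> (fact N * weight (int n) N) * ((1 + real N) * (1 + \<bar>real N - real n\<bar>))"
    by (intro mult_mono) auto
  then show ?case by (simp add: weight_Suc algebra_simps)
qed

text \<open>
  The central estimate: its right-hand side is independent of \<open>n\<close> and summable over \<open>k\<close>.
\<close>

lemma power_div_weight_le:
  assumes "N \<le> k"
  shows "real n ^ N / weight (int n) k \<le> fact N * 2 ^ k / fact (k - N)"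
proof -
  define i where "i = k - N"
  have k: "k = N + i" using assms by (simp add: i_def)
  have "real n ^ N * fact i \<le> (fact N * weight (int n) N) * (2 ^ i * weight (int n - int N) i)"
    by (intro mult_mono power_le_fact_weight fact_le_weight)
       auto
  also have "\<dots> = fact N * 2 ^ i * weight (int n) k"
    by (simp add: k weight_add)
  also have "\<dots> \<le> fact N * 2 ^ k * weight (int n) k"
    by (intro mult_mono power_increasing) (auto simp: k)
  finally show ?thesis
    using weight_pos[of "int n" k] by (simp add: field_simps i_def)
qed

section \<open>Comparing Pochhammer symbols with the model product\<close>

text \<open>
  For \<open>\<bar>i\<bar> \<ge> 2 * norm c + 1\<close> the triangle inequality gives the constant \<open>1/2\<close>. Only finitely
  many \<open>i\<close> remain, and each contributes a positive ratio. The set \<open>M\<close> of admissible translations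
  covers both non-integrality (\<open>M = UNIV\<close>) and not being a nonpositive integer
  (\<open>M = {0..}\<close>).
\<close>

lemma norm_add_of_int_ge:
  fixes c :: complex
  assumes "\<And>i. i \<in> M \<Longrightarrow> c + of_int i \<noteq> 0"
  shows "\<exists>\<delta>>0. \<forall>i\<in>M. \<delta> * (1 + \<bar>real_of_int i\<bar>) \<le> norm (c + of_int i)"
proof -
  define R where "R = \<lceil>2 * norm c + 1\<rceil>"
  define F where "F = M \<inter> {-R..R}"
  define \<delta> where "\<delta> = Min (insert (1/2) ((\<lambda>i. norm (c + of_int i) / (1 + \<bar>real_of_int i\<bar>)) ` F))"
  have fin: "finite F" by (simp add: F_def)
  have "\<delta> > 0"
    unfolding \<delta>_def using fin assms
    by (subst Min_gr_iff) (auto simp: F_def intro!: divide_pos_pos)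
  moreover have "\<delta> * (1 + \<bar>real_of_int i\<bar>) \<le> norm (c + of_int i)" if "i \<in> M" for i
  proof (cases "i \<in> F")
    case True
    then have "\<delta> \<le> norm (c + of_int i) / (1 + \<bar>real_of_int i\<bar>)"
      unfolding \<delta>_def using fin by (intro Min_le) auto
    then show ?thesis by (simp add: field_simps)
  next
    case False
    have "\<delta> \<le> 1/2" unfolding \<delta>_def using fin by (intro Min_le) auto
    then have "\<delta> * (1 + \<bar>real_of_int i\<bar>) \<le> 1/2 * (1 + \<bar>real_of_int i\<bar>)"
      by (intro mult_right_mono) auto
    also have "\<dots> \<le> \<bar>real_of_int i\<bar> - norm c"
    proof -
      have "\<bar>i\<bar> > R" using False that by (auto simp: F_def)
      then have "\<bar>real_of_int i\<bar> \<ge> 2 * norm c + 1" unfolding R_def by linarith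
      then show ?thesis by (simp add: field_simps)
    qed
    also have "\<dots> \<le> norm (c + of_int i)"
      using norm_triangle_ineq2[of "of_int i :: complex" "- c"] by (simp add: add.commute)
    finally show ?thesis .
  qed
  ultimately show ?thesis by blast
qed

lemma norm_pochhammer_le:
  "norm (pochhammer (a - of_int m :: complex) k) \<le> (1 + norm a) ^ k * weight m k"
proof -
  have "norm (a - of_int m + of_nat j) \<le> (1 + norm a) * (1 + \<bar>real j - real_of_int m\<bar>)" for j
  proof -
    have "norm (a - of_int m + of_nat j) \<le> norm a + norm (of_int (int j - m) :: complex)"
      using norm_triangle_ineq[of a "of_int (int j - m)"] by (simp add: algebra_simps)
    also have "norm (of_int (int j - m) :: complex) = \<bar>real j - real_of_int m\<bar>"
      by (subst norm_of_int) simp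
    also have "norm a + \<bar>real j - real_of_int m\<bar> \<le> (1 + norm a) * (1 + \<bar>real j - real_of_int m\<bar>)"
      by (simp add: algebra_simps)
    finally show ?thesis .
  qed
  then have "(\<Prod>j<k. norm (a - of_int m + of_nat j)) \<le> (\<Prod>j<k. (1 + norm a) * (1 + \<bar>real j - real_of_int m\<bar>))"
    by (intro prod_mono) auto
  then show ?thesis
    by (simp add: pochhammer_prod atLeast0LessThan prod_norm[symmetric] weight_def prod.distrib)
qed

lemma norm_pochhammer_ge:
  fixes c :: complex
  assumes \<delta>: "\<delta> > 0" "\<And>i. i \<in> M \<Longrightarrow> \<delta> * (1 + \<bar>real_of_int i\<bar>) \<le> norm (c + of_int i)"
    and M: "\<And>j. j < k \<Longrightarrow> int j - m \<in> M"
  shows "\<delta> ^ k * weight m k \<le> norm (pochhammer (c - of_int m) k)"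
proof -
  have "(\<Prod>j<k. \<delta> * (1 + \<bar>real j - real_of_int m\<bar>)) \<le> (\<Prod>j<k. norm (c - of_int m + of_nat j))"
  proof (intro prod_mono conjI)
    fix j assume "j \<in> {..<k}"
    then show "\<delta> * (1 + \<bar>real j - real_of_int m\<bar>) \<le> norm (c - of_int m + of_nat j)"
      using \<delta>(2)[OF M[of j]] by (simp add: algebra_simps)
  qed (use \<delta> in auto)
  then show ?thesis
    by (simp add: pochhammer_prod atLeast0LessThan prod_norm[symmetric] weight_def prod.distrib)
qed

lemma norm_prod_pochhammer_le:
  "\<exists>K\<ge>1. \<forall>m k. norm (\<Prod>a\<leftarrow>as. pochhammer (a - of_int m :: complex) k) \<le> K ^ k * weight m k ^ length as"
proof (induction as)
  case Nil
  show ?case by (intro exI[of _ 1]) auto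
next
  case (Cons a as)
  then obtain K where K: "K \<ge> 1"
    "\<And>m k. norm (\<Prod>a\<leftarrow>as. pochhammer (a - of_int m) k) \<le> K ^ k * weight m k ^ length as"
    by blast
  have "norm (\<Prod>a\<leftarrow>a#as. pochhammer (a - of_int m) k)
      \<le> ((1 + norm a) * K) ^ k * weight m k ^ length (a # as)" for m k
    using mult_mono[OF norm_pochhammer_le[of a m k] K(2)[of m k]] weight_pos[of m k]
    by (simp add: norm_mult power_mult_distrib mult_ac)
  moreover have "(1 + norm a) * K \<ge> 1"
    using K(1) mult_mono[of 1 "1 + norm a" 1 K] by simp
  ultimately show ?case by blast
qed

lemma norm_prod_pochhammer_ge:
  assumes "\<And>c i. c \<in> set cs \<Longrightarrow> i \<in> M \<Longrightarrow> c + of_int i \<noteq> (0::complex)"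
  shows "\<exists>\<delta>>0. \<forall>m k. (\<forall>j<k. int j - m \<in> M) \<longrightarrow>
    \<delta> ^ k * weight m k ^ length cs \<le> norm (\<Prod>c\<leftarrow>cs. pochhammer (c - of_int m) k)"
  using assms
proof (induction cs)
  case Nil
  show ?case by (intro exI[of _ 1]) auto
next
  case (Cons c cs)
  then obtain \<delta> where \<delta>: "\<delta> > 0" "\<And>m k. (\<forall>j<k. int j - m \<in> M) \<Longrightarrow>
    \<delta> ^ k * weight m k ^ length cs \<le> norm (\<Prod>c\<leftarrow>cs. pochhammer (c - of_int m) k)"
    by (metis list.set_intros(2))
  obtain \<epsilon> where \<epsilon>: "\<epsilon> > 0" "\<And>i. i \<in> M \<Longrightarrow> \<epsilon> * (1 + \<bar>real_of_int i\<bar>) \<le> norm (c + of_int i)"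
    using norm_add_of_int_ge[of M c] Cons.prems by auto
  have "(\<epsilon> * \<delta>) ^ k * weight m k ^ length (c # cs)
      \<le> norm (\<Prod>c\<leftarrow>c#cs. pochhammer (c - of_int m) k)" if "\<forall>j<k. int j - m \<in> M" for m k
    using mult_mono[OF norm_pochhammer_ge[OF \<epsilon>, where k = k and m = m] \<delta>(2)[OF that]] that weight_pos[of m k] \<delta>(1)
    by (simp add: norm_mult power_mult_distrib mult_ac)
  then show ?case using \<epsilon>(1) \<delta>(1) by (intro exI[of _ "\<epsilon> * \<delta>"]) auto
qed

text \<open>
  Upper and lower shifts are kept separate because the second expansion needs
  \<open>pochhammer (d - b) j / pochhammer (d - n) j\<close>, in which only the denominator moves with \<open>n\<close>.
\<close>

lemma norm_pochhammer_quotient_le: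
  assumes "\<And>c i. c \<in> set cs \<Longrightarrow> i \<in> M \<Longrightarrow> c + of_int i \<noteq> (0::complex)"
  obtains K where "K \<ge> 1"
    "\<And>m m' k. (\<And>j. j < k \<Longrightarrow> int j - m' \<in> M) \<Longrightarrow>
       norm ((\<Prod>a\<leftarrow>as. pochhammer (a - of_int m) k) / (\<Prod>c\<leftarrow>cs. pochhammer (c - of_int m') k))
       \<le> K ^ k * (weight m k ^ length as / weight m' k ^ length cs)"
proof -
  obtain A where A: "A \<ge> 1"
    "\<And>m k. norm (\<Prod>a\<leftarrow>as. pochhammer (a - of_int m) k) \<le> A ^ k * weight m k ^ length as"
    using norm_prod_pochhammer_le by blast
  obtain \<delta> where \<delta>: "\<delta> > 0" "\<And>m k. (\<forall>j<k. int j - m \<in> M) \<Longrightarrow>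
    \<delta> ^ k * weight m k ^ length cs \<le> norm (\<Prod>c\<leftarrow>cs. pochhammer (c - of_int m) k)"
    using norm_prod_pochhammer_ge[OF assms] by metis
  define K where "K = max 1 (A / \<delta>)"
  show thesis
  proof (rule that[of K])
    show "K \<ge> 1" by (simp add: K_def)
  next
    fix m m' :: int and k :: nat
    assume M: "\<And>j. j < k \<Longrightarrow> int j - m' \<in> M"
    have "norm ((\<Prod>a\<leftarrow>as. pochhammer (a - of_int m) k) / (\<Prod>c\<leftarrow>cs. pochhammer (c - of_int m') k))
      \<le> (A ^ k * weight m k ^ length as) / (\<delta> ^ k * weight m' k ^ length cs)"
      unfolding norm_divide using A \<delta> M weight_pos
      by (intro frac_le) (auto intro!: mult_pos_pos mult_nonneg_nonneg simp: less_imp_le)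
    also have "\<dots> = (A / \<delta>) ^ k * (weight m k ^ length as / weight m' k ^ length cs)"
      by (simp add: power_divide)
    also have "\<dots> \<le> K ^ k * (weight m k ^ length as / weight m' k ^ length cs)"
      using A(1) \<delta>(1) weight_pos
      by (intro mult_right_mono power_mono) (auto simp: K_def less_imp_le)
    finally show "norm ((\<Prod>a\<leftarrow>as. pochhammer (a - of_int m) k) / (\<Prod>c\<leftarrow>cs. pochhammer (c - of_int m') k))
       \<le> K ^ k * (weight m k ^ length as / weight m' k ^ length cs)" .
  qed
qed

section \<open>Dominated series\<close>

text \<open>
  Domination already yields summability of \<open>t n\<close> for \<open>n > 0\<close>, so the representation of \<open>f n\<close>
  as a series may be derived from that summability. This is how convergence of the
  hypergeometric series themselves is obtained below.
\<close>

lemma bigo_of_dominated_series: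
  fixes t :: "nat \<Rightarrow> nat \<Rightarrow> complex"
  assumes u: "summable u"
    and t: "\<And>n k. n > 0 \<Longrightarrow> real n ^ e * norm (t n k) \<le> u k"
    and f: "\<And>n. n > 0 \<Longrightarrow> summable (t n) \<Longrightarrow> f n = (\<Sum>k. t n k)"
  shows "f \<in> O[at_top](\<lambda>n. of_nat n powi (- int e))"
proof (rule bigoI)
  show "\<forall>\<^sub>F n in at_top. norm (f n) \<le> (\<Sum>k. u k) * norm (of_nat n powi (- int e) :: complex)"
    using eventually_gt_at_top[of 0]
  proof eventually_elim
    case (elim n)
    have le: "norm (t n k) \<le> u k / real n ^ e" for k
      using t[OF elim, of k] elim by (simp add: field_simps)
    have sum_u: "summable (\<lambda>k. u k / real n ^ e)"
      by (intro summable_divide u)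
    have "f n = (\<Sum>k. t n k)"
      using f[OF elim] summable_comparison_test'[OF sum_u, of 0] le by blast
    also have "norm \<dots> \<le> (\<Sum>k. u k / real n ^ e)"
      by (intro norm_suminf_le le sum_u)
    also have "\<dots> = (\<Sum>k. u k) / real n ^ e"
      by (rule suminf_divide[OF u])
    also have "\<dots> = (\<Sum>k. u k) * norm (of_nat n powi (- int e) :: complex)"
      by (simp add: power_int_minus norm_inverse norm_power divide_inverse)
    finally show ?case .
  qed
qed

lemma summable_power_div_fact_diff: "summable (\<lambda>k. x ^ k / fact (k - N) :: real)"
proof -
  have "summable (\<lambda>i. x ^ N * (x ^ i / fact i))"
    by (intro summable_mult) (use summable_exp[of x] in \<open>simp add: divide_inverse mult.commute\<close>)
  then show ?thesis
    by (subst summable_iff_shift[of _ N, symmetric]) (simp add: power_add mult_ac)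
qed

section \<open>The two expansions\<close>

text \<open>
  The Chu-Vandermonde identity with parameters \<open>-k\<close> and \<open>d - b\<close> over \<open>d\<close>; the symbol
  \<open>pochhammer (- k) j / fact j\<close> is a signed binomial coefficient.
\<close>

lemma pochhammer_quotient_eq_sum:
  fixes b d :: complex
  assumes "\<And>i. d + of_nat i \<noteq> 0"
  shows "pochhammer b k / pochhammer d k
    = (\<Sum>j\<le>k. (-1) ^ j * of_nat (k choose j) * (pochhammer (d - b) j / pochhammer d j))"
proof -
  have "\<forall>i\<in>{0..<k}. d \<noteq> - of_nat i"
    using assms by (metis add.left_inverse)
  from Vandermonde_pochhammer[OF this, of "d - b"] show ?thesis
    by (simp add: atLeast0AtMost binomial_gbinomial gbinomial_pochhammer mult_ac)
qed

text \<open>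
  The remainder is the tail \<open>k \<ge> N\<close>. Since \<open>n ^ N / weight n k\<close> occurs to the power
  \<open>e = length cs - length as \<ge> 1\<close>, the tail, multiplied by \<open>n ^ (e * N)\<close>, is dominated by a
  multiple of \<open>x ^ k / fact (k - N)\<close>.
\<close>

lemma hypergeom_shifted_lower_remainder:
  fixes as bs cs ds :: "complex list" and z :: complex
  assumes pq: "length as + 1 \<le> length cs" and rs: "length bs \<le> length ds + 1"
    and cs: "\<forall>c\<in>set cs. c \<notin> \<int>" and ds: "\<forall>d\<in>set ds. d \<notin> \<int>\<^sub>\<le>\<^sub>0"
  shows "(\<lambda>n::nat.
      hypergeom (map (\<lambda>a. a - of_nat n) as @ bs) (map (\<lambda>c. c - of_nat n) cs @ ds) z
      - (\<Sum>k<N. (\<Prod>a\<leftarrow>as. pochhammer (a - of_nat n) k) / (\<Prod>c\<leftarrow>cs. pochhammer (c - of_nat n) k)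
          * ((\<Prod>b\<leftarrow>bs. pochhammer b k) / (\<Prod>d\<leftarrow>ds. pochhammer d k)) * (z ^ k / fact k)))
    \<in> O[at_top](\<lambda>n. of_nat n powi (- int ((length cs - length as) * N)))"
proof -
  define e where "e = length cs - length as"
  have e: "length cs = length as + e" "e \<ge> 1" using pq by (auto simp: e_def)
  define T where "T n k = (\<Prod>a\<leftarrow>as. pochhammer (a - of_nat n) k) / (\<Prod>c\<leftarrow>cs. pochhammer (c - of_nat n) k)
          * ((\<Prod>b\<leftarrow>bs. pochhammer b k) / (\<Prod>d\<leftarrow>ds. pochhammer d k)) * (z ^ k / fact k)" for n k :: nat
  have cs': "c + of_int i \<noteq> 0" if "c \<in> set cs" for c i
    using cs that by (metis Ints_minus Ints_of_int add_eq_0_iff2)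
  have ds': "d + of_int i \<noteq> 0" if "d \<in> set ds" "i \<in> {0..}" for d i
  proof
    assume "d + of_int i = 0"
    then have "d = of_int (- i)" by (simp add: add_eq_0_iff2)
    with ds that show False by (metis atLeast_iff neg_le_0_iff_le nonpos_Ints_of_int)
  qed
  obtain K where K: "K \<ge> 1"
    "\<And>n k. norm ((\<Prod>a\<leftarrow>as. pochhammer (a - of_nat n) k) / (\<Prod>c\<leftarrow>cs. pochhammer (c - of_nat n) k))
       \<le> K ^ k * (weight (int n) k ^ length as / weight (int n) k ^ length cs)"
    using norm_pochhammer_quotient_le[of cs UNIV as] cs'
    by (metis UNIV_I of_int_of_nat_eq)
  obtain L where L: "L \<ge> 1"
    "\<And>k. norm ((\<Prod>b\<leftarrow>bs. pochhammer b k) / (\<Prod>d\<leftarrow>ds. pochhammer d k))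
       \<le> L ^ k * (fact k ^ length bs / fact k ^ length ds)"
  proof (rule norm_pochhammer_quotient_le[of ds "{0..}" bs])
    fix L :: real
    assume L: "L \<ge> 1" "\<And>m m' k. (\<And>j. j < k \<Longrightarrow> int j - m' \<in> {0..}) \<Longrightarrow>
       norm ((\<Prod>b\<leftarrow>bs. pochhammer (b - of_int m) k) / (\<Prod>d\<leftarrow>ds. pochhammer (d - of_int m') k))
       \<le> L ^ k * (weight m k ^ length bs / weight m' k ^ length ds)"
    show thesis
      using L(1) L(2)[of _ 0 0] by (intro that[of L]) (auto simp: weight_0_eq_fact)
  qed (use ds' in auto)
  define x where "x = K * L * 2 ^ e * norm z"
  have bound: "real n ^ (e * N) * norm (T n k) \<le> fact N ^ e * (x ^ k / fact (k - N))"
    if "k \<ge> N" for n k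
  proof -
    define w where "w = weight (int n) k"
    have w: "w > 0" unfolding w_def by (rule weight_pos)
    have "real n ^ (e * N) * (w ^ length as / w ^ length cs) = (real n ^ N / w) ^ e"
      using w by (simp add: e power_add power_divide power_mult[symmetric] mult.commute)
    also have "\<dots> \<le> (fact N * 2 ^ k / fact (k - N)) ^ e"
      using power_div_weight_le[OF that, of n] w unfolding w_def by (intro power_mono) auto
    also have "\<dots> = fact N ^ e * (2 ^ e) ^ k / fact (k - N) ^ e"
      by (simp add: power_divide power_mult_distrib power_mult[symmetric] mult.commute)
    \<comment> \<open>A single factorial suffices for summability, so the surplus ones are dropped; this is where \<open>e \<ge> 1\<close> enters.\<close>
    also have "\<dots> \<le> fact N ^ e * (2 ^ e) ^ k / fact (k - N)"
      using e(2) by (intro divide_left_mono) (auto intro: self_le_power)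
    finally have 1: "real n ^ (e * N) * (w ^ length as / w ^ length cs)
      \<le> fact N ^ e * (2 ^ e) ^ k / fact (k - N)" .
    have "fact k ^ length bs \<le> (fact k ^ (length ds + 1) :: real)"
      using rs by (intro power_increasing) auto
    then have 2: "fact k ^ length bs / fact k ^ length ds \<le> (fact k :: real)"
      by (simp add: field_simps)
    have "real n ^ (e * N) * norm (T n k) \<le> real n ^ (e * N) *
        ((K ^ k * (w ^ length as / w ^ length cs)) * (L ^ k * fact k) * (norm z ^ k / fact k))"
      unfolding T_def norm_mult
    proof (intro mult_left_mono mult_mono)
      show "norm ((\<Prod>a\<leftarrow>as. pochhammer (a - of_nat n) k) / (\<Prod>c\<leftarrow>cs. pochhammer (c - of_nat n) k))
          \<le> K ^ k * (w ^ length as / w ^ length cs)" unfolding w_def by (rule K)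
      show "norm ((\<Prod>b\<leftarrow>bs. pochhammer b k) / (\<Prod>d\<leftarrow>ds. pochhammer d k)) \<le> L ^ k * fact k"
        by (rule order.trans[OF L(2)], rule mult_left_mono[OF 2]) (use L(1) in auto)
    qed (use K(1) L(1) w in \<open>auto simp: norm_divide norm_power\<close>)
    also have "\<dots> = (real n ^ (e * N) * (w ^ length as / w ^ length cs)) * (K * L * norm z) ^ k"
      by (simp add: power_mult_distrib)
    also have "\<dots> \<le> (fact N ^ e * (2 ^ e) ^ k / fact (k - N)) * (K * L * norm z) ^ k"
      using K(1) L(1) by (intro mult_right_mono 1) auto
    also have "\<dots> = fact N ^ e * (x ^ k / fact (k - N))"
      by (simp add: x_def power_mult_distrib)
    finally show ?thesis .
  qed
  have "(\<lambda>n. (\<Sum>k. T n k) - (\<Sum>k<N. T n k)) \<in> O[at_top](\<lambda>n. of_nat n powi (- int (e * N)))"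
  proof (rule bigo_of_dominated_series[where t = "\<lambda>n i. T n (i + N)"])
    show "summable (\<lambda>i. fact N ^ e * (x ^ (i + N) / fact i))"
      using summable_mult[OF summable_ignore_initial_segment[OF summable_power_div_fact_diff[of x N], of N]]
      by simp
    show "real n ^ (e * N) * norm (T n (i + N)) \<le> fact N ^ e * (x ^ (i + N) / fact i)" for n i
      using bound[of "i + N" n] by simp
    show "(\<Sum>k. T n k) - (\<Sum>k<N. T n k) = (\<Sum>i. T n (i + N))"
      if "summable (\<lambda>i. T n (i + N))" for n
      using that suminf_minus_initial_segment[of "T n" N] by simp
  qed
  then show ?thesis
    by (simp add: T_def hypergeom_def e_def o_def)
qed

text \<open>
  The terms with \<open>k < j\<close> vanish; in the others, \<open>k = i + j\<close>, both
  \<open>pochhammer a (i + j) = pochhammer a j * pochhammer (a + j) i\<close> and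
  \<open>(i + j choose j) / fact (i + j) = 1 / (fact i * fact j)\<close> separate \<open>i\<close> from \<open>j\<close>.
\<close>

lemma sum_binomial_shift_hypergeom:
  fixes as cs :: "complex list" and z :: complex
  assumes summ: "summable (\<lambda>k. (\<Prod>a\<leftarrow>as. pochhammer a k) / (\<Prod>c\<leftarrow>cs. pochhammer c k)
      * (z ^ k / fact k) * of_nat (k choose j))"
  shows "(\<Sum>k. (\<Prod>a\<leftarrow>as. pochhammer a k) / (\<Prod>c\<leftarrow>cs. pochhammer c k)
      * (z ^ k / fact k) * of_nat (k choose j))
    = (\<Prod>a\<leftarrow>as. pochhammer a j) / (\<Prod>c\<leftarrow>cs. pochhammer c j) * (z ^ j / fact j)
      * hypergeom (map (\<lambda>a. a + of_nat j) as) (map (\<lambda>c. c + of_nat j) cs) z"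
    (is "suminf ?g = ?P * _ * _")
proof -
  define h where "h i = (\<Prod>a\<leftarrow>as. pochhammer (a + of_nat j) i) / (\<Prod>c\<leftarrow>cs. pochhammer (c + of_nat j) i)
    * (z ^ i / fact i)" for i
  have prod_split: "(\<Prod>a\<leftarrow>xs. pochhammer a (i + j))
      = (\<Prod>a\<leftarrow>xs. pochhammer a j) * (\<Prod>a\<leftarrow>xs. pochhammer (a + of_nat j) i)" for xs :: "complex list" and i
    by (induction xs) (simp_all add: pochhammer_product'[of _ j i] add.commute[of i j] mult_ac)
  have binom: "of_nat ((i + j) choose j) = (fact (i + j) / (fact i * fact j) :: complex)" for i
    by (simp add: binomial_fact mult.commute)
  have g: "?g (i + j) = ?P * (z ^ j / fact j) * h i" for i
    by (simp add: prod_split binom h_def power_add field_simps)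
  have "?P * (z ^ j / fact j) * (\<Sum>i. h i) = (\<Sum>i. ?g (i + j))"
  proof (cases "?P * (z ^ j / fact j) = 0")
    case True
    then show ?thesis
      unfolding g by (simp only: True mult_zero_left suminf_zero)
  next
    case False
    have "summable (\<lambda>i. ?P * (z ^ j / fact j) * h i)"
      using summable_ignore_initial_segment[OF summ, of j] unfolding g .
    with False have "summable h"
      by (auto simp: summable_cmult_iff simp del: mult_eq_0_iff)
    then show ?thesis unfolding g by (rule suminf_mult[symmetric])
  qed
  also have "\<dots> = suminf ?g"
  proof -
    have "(\<Sum>k<j. ?g k) = 0"
      by (rule sum.neutral) (simp add: binomial_eq_0)
    then show ?thesis
      using suminf_minus_initial_segment[OF summ, of j] by (simp only: diff_zero)
  qed
  finally show ?thesis
    by (simp add: hypergeom_def h_def o_def)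
qed

text \<open>
  After the Chu-Vandermonde expansion of the shifted pair, \<open>g j k\<close> collects the part of the
  \<open>j\<close>-th contribution that does not depend on \<open>n\<close>, and \<open>t n k\<close> the contributions with
  \<open>j \<ge> N\<close>.
\<close>

lemma hypergeom_one_shifted_pair_remainder:
  fixes as cs :: "complex list" and b d z :: complex
  assumes len: "length as = length cs"
    and cs: "\<forall>c\<in>set cs. c \<notin> \<int>\<^sub>\<le>\<^sub>0" and d: "d \<notin> \<int>"
  shows "(\<lambda>n::nat.
      hypergeom (as @ [b - of_nat n]) (cs @ [d - of_nat n]) z
      - (\<Sum>k<N. (\<Prod>a\<leftarrow>as. pochhammer a k) / (\<Prod>c\<leftarrow>cs. pochhammer c k)
                * (pochhammer (d - b) k / pochhammer (d - of_nat n) k)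
                * ((- z) ^ k / fact k)
                * hypergeom (map (\<lambda>a. a + of_nat k) as) (map (\<lambda>c. c + of_nat k) cs) z))
    \<in> O[at_top](\<lambda>n. of_nat n powi (- int N))"
proof -
  define P where "P k = (\<Prod>a\<leftarrow>as. pochhammer a k) / (\<Prod>c\<leftarrow>cs. pochhammer c k)" for k
  define Q where "Q n j = pochhammer (d - b) j / pochhammer (d - of_nat n) j" for n j :: nat
  define g where "g j k = P k * (z ^ k / fact k) * of_nat (k choose j)" for j k
  define t where "t n k = P k * (z ^ k / fact k) *
    (\<Sum>j\<in>{N..k}. (-1) ^ j * of_nat (k choose j) * Q n j)" for n k
  have d': "d + of_int i \<noteq> 0" for i
    using d by (metis Ints_minus Ints_of_int add_eq_0_iff2)
  have cs': "c + of_int i \<noteq> 0" if "c \<in> set cs" "i \<in> {0..}" for c i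
  proof
    assume "c + of_int i = 0"
    then have "c = of_int (- i)" by (simp add: add_eq_0_iff2)
    with cs that show False by (metis atLeast_iff neg_le_0_iff_le nonpos_Ints_of_int)
  qed
  obtain K where K: "K \<ge> 1" "\<And>k. norm (P k) \<le> K ^ k"
  proof (rule norm_pochhammer_quotient_le[of cs "{0..}" as])
    fix K :: real
    assume K: "K \<ge> 1" "\<And>m m' k. (\<And>j. j < k \<Longrightarrow> int j - m' \<in> {0..}) \<Longrightarrow>
       norm ((\<Prod>a\<leftarrow>as. pochhammer (a - of_int m) k) / (\<Prod>c\<leftarrow>cs. pochhammer (c - of_int m') k))
       \<le> K ^ k * (weight m k ^ length as / weight m' k ^ length cs)"
    show thesis
      using K(1) K(2)[of _ 0 0] by (intro that[of K]) (auto simp: weight_0_eq_fact len P_def)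
  qed (use cs' in auto)
  obtain L where L: "L \<ge> 1" "\<And>n j. norm (Q n j) \<le> L ^ j * (fact j / weight (int n) j)"
  proof (rule norm_pochhammer_quotient_le[of "[d]" UNIV "[d - b]"])
    fix L :: real
    assume L: "L \<ge> 1" "\<And>m m' k. (\<And>j. j < k \<Longrightarrow> int j - m' \<in> UNIV) \<Longrightarrow>
       norm ((\<Prod>a\<leftarrow>[d - b]. pochhammer (a - of_int m) k) / (\<Prod>c\<leftarrow>[d]. pochhammer (c - of_int m') k))
       \<le> L ^ k * (weight m k ^ length [d - b] / weight m' k ^ length [d])"
    show thesis
      using L(1) L(2)[of _ "int n" 0 for n]
      by (intro that[of L]) (auto simp: weight_0_eq_fact Q_def)
  qed (use d' in auto)
  have Q_bound: "real n ^ N * norm (Q n j) \<le> fact N ^ 2 * (4 * L) ^ j" if "j \<ge> N" for n j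
  proof -
    \<comment> \<open>The numerator \<open>pochhammer (d - b) j\<close> has the size of \<open>fact j\<close>, which cancels \<open>fact (j - N)\<close> from the weight estimate up to an exponential factor.\<close>
    have "fact j = fact N * fact (j - N) * real (j choose N)"
      using binomial_fact_lemma[OF that] by (metis of_nat_fact of_nat_mult)
    also have "\<dots> \<le> fact N * fact (j - N) * 2 ^ j"
      using binomial_le_pow2[of j N]
      by (intro mult_left_mono) (simp_all flip: of_nat_power add: numeral_power_le_of_nat_cancel_iff)
    finally have fact_j: "fact j \<le> fact N * fact (j - N) * (2 ^ j :: real)" .
    have "real n ^ N * norm (Q n j) \<le> real n ^ N * (L ^ j * (fact j / weight (int n) j))"
      by (intro mult_left_mono L) auto
    also have "\<dots> = (real n ^ N / weight (int n) j) * (L ^ j * fact j)"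
      by simp
    also have "\<dots> \<le> (fact N * 2 ^ j / fact (j - N)) * (L ^ j * (fact N * fact (j - N) * 2 ^ j))"
      using L(1) by (intro mult_mono power_div_weight_le[OF that] fact_j mult_left_mono) auto
    also have "\<dots> = fact N ^ 2 * (2 * 2 * L) ^ j"
      by (simp only: power_mult_distrib) (simp add: power2_eq_square)
    finally show ?thesis by simp
  qed
  define x where "x = K * (4 * L + 1) * norm z"
  have bound: "real n ^ N * norm (t n k) \<le> fact N ^ 2 * (x ^ k / fact k)" for n k
  proof -
    have "real n ^ N * norm (\<Sum>j\<in>{N..k}. (-1) ^ j * of_nat (k choose j) * Q n j)
        \<le> real n ^ N * (\<Sum>j\<in>{N..k}. real (k choose j) * norm (Q n j))"
      by (intro mult_left_mono sum_norm_le) (simp_all add: norm_mult norm_power)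
    also have "\<dots> = (\<Sum>j\<in>{N..k}. real (k choose j) * (real n ^ N * norm (Q n j)))"
      by (simp add: sum_distrib_left mult_ac)
    also have "\<dots> \<le> (\<Sum>j\<in>{N..k}. real (k choose j) * (fact N ^ 2 * (4 * L) ^ j))"
      by (intro sum_mono mult_left_mono Q_bound) auto
    also have "\<dots> \<le> (\<Sum>j\<le>k. real (k choose j) * (fact N ^ 2 * (4 * L) ^ j))"
      using L(1) by (intro sum_mono2) auto
    also have "\<dots> = fact N ^ 2 * (4 * L + 1) ^ k"
      unfolding binomial_ring[of "4 * L" 1] sum_distrib_left by (simp add: mult_ac)
    finally have 1: "real n ^ N * norm (\<Sum>j\<in>{N..k}. (-1) ^ j * of_nat (k choose j) * Q n j)
        \<le> fact N ^ 2 * (4 * L + 1) ^ k" .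
    have "real n ^ N * norm (t n k) = norm (P k) * (norm z ^ k / fact k) *
        (real n ^ N * norm (\<Sum>j\<in>{N..k}. (-1) ^ j * of_nat (k choose j) * Q n j))"
      by (simp add: t_def norm_mult norm_divide norm_power)
    also have "\<dots> \<le> K ^ k * (norm z ^ k / fact k) * (fact N ^ 2 * (4 * L + 1) ^ k)"
      using K(1) by (intro mult_mono K 1 mult_nonneg_nonneg) auto
    also have "\<dots> = fact N ^ 2 * (x ^ k / fact k)"
      by (simp add: x_def power_mult_distrib)
    finally show ?thesis .
  qed
  have g_summable: "summable (g j)" for j
  proof (rule summable_comparison_test')
    show "summable (\<lambda>k. (K * norm z * 2) ^ k / fact k)"
      using summable_power_div_fact_diff[of "K * norm z * 2" 0] by (simp only: diff_zero)
    show "norm (g j k) \<le> (K * norm z * 2) ^ k / fact k" for k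
    proof -
      have "norm (g j k) = norm (P k) * (norm z ^ k / fact k) * real (k choose j)"
        by (simp add: g_def norm_mult norm_divide norm_power)
      also have "\<dots> \<le> K ^ k * (norm z ^ k / fact k) * 2 ^ k"
        using binomial_le_pow2[of k j] K(1)
        by (intro mult_mono K)
           (auto simp flip: of_nat_power simp: numeral_power_le_of_nat_cancel_iff)
      finally show ?thesis by (simp add: power_mult_distrib)
    qed
  qed
  have term_eq: "P k * (pochhammer (b - of_nat n) k / pochhammer (d - of_nat n) k) * (z ^ k / fact k)
      = t n k + (\<Sum>j<N. (-1) ^ j * Q n j * g j k)" for n k
  proof -
    have "pochhammer (b - of_nat n) k / pochhammer (d - of_nat n) k
        = (\<Sum>j\<le>k. (-1) ^ j * of_nat (k choose j) * Q n j)"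
      using d'[of "int i - int n" for i]
      by (subst pochhammer_quotient_eq_sum) (simp_all add: Q_def algebra_simps)
    \<comment> \<open>If \<open>k < N\<close>, indices above \<open>k\<close> are added here; their binomial coefficients are zero.\<close>
    also have "\<dots> = (\<Sum>j\<in>{N..k} \<union> {..<N}. (-1) ^ j * of_nat (k choose j) * Q n j)"
      by (rule sum.mono_neutral_left) (auto simp: binomial_eq_0)
    also have "\<dots> = (\<Sum>j\<in>{N..k}. (-1) ^ j * of_nat (k choose j) * Q n j)
        + (\<Sum>j<N. (-1) ^ j * of_nat (k choose j) * Q n j)"
      by (rule sum.union_disjoint) auto
    finally show ?thesis
      by (simp add: t_def g_def sum_distrib_left algebra_simps)
  qed
  define H where "H n = hypergeom (as @ [b - of_nat n]) (cs @ [d - of_nat n]) z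
    - (\<Sum>j<N. (-1) ^ j * Q n j * (\<Sum>k. g j k))" for n
  have H_bigo: "H \<in> O[at_top](\<lambda>n. of_nat n powi (- int N))"
  proof (rule bigo_of_dominated_series[OF _ bound])
    show "summable (\<lambda>k. fact N ^ 2 * (x ^ k / fact k))"
      using summable_mult[OF summable_power_div_fact_diff[of x 0]] by simp
    fix n assume t: "summable (t n)"
    have "(\<lambda>k. t n k + (\<Sum>j<N. (-1) ^ j * Q n j * g j k))
        sums ((\<Sum>k. t n k) + (\<Sum>j<N. (-1) ^ j * Q n j * (\<Sum>k. g j k)))"
      by (intro sums_add sums_sum sums_mult summable_sums t g_summable)
    then have "(\<Sum>k. P k * (pochhammer (b - of_nat n) k / pochhammer (d - of_nat n) k) * (z ^ k / fact k))
        = (\<Sum>k. t n k) + (\<Sum>j<N. (-1) ^ j * Q n j * (\<Sum>k. g j k))"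
      unfolding term_eq by (rule sums_unique[symmetric])
    moreover have "hypergeom (as @ [b - of_nat n]) (cs @ [d - of_nat n]) z
        = (\<Sum>k. P k * (pochhammer (b - of_nat n) k / pochhammer (d - of_nat n) k) * (z ^ k / fact k))"
      by (simp add: hypergeom_def P_def)
    ultimately show "H n = (\<Sum>k. t n k)"
      by (simp add: H_def)
  qed
  have g_sum: "(-1) ^ j * Q n j * (\<Sum>k. g j k) = P j * Q n j * ((- z) ^ j / fact j)
      * hypergeom (map (\<lambda>a. a + of_nat j) as) (map (\<lambda>c. c + of_nat j) cs) z" for n j
  proof -
    have "(\<Sum>k. g j k) = P j * (z ^ j / fact j)
        * hypergeom (map (\<lambda>a. a + of_nat j) as) (map (\<lambda>c. c + of_nat j) cs) z"
      using g_summable[of j] unfolding g_def P_def by (rule sum_binomial_shift_hypergeom)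
    then show ?thesis by (simp add: power_minus[of z])
  qed
  show ?thesis
    using H_bigo unfolding H_def g_sum unfolding P_def Q_def .
qed

theorem theorem4p5:
  fixes z :: complex
  shows
   "(\<forall>(p::nat) (q::nat) (r::nat) (s::nat)
       (as::complex list) (bs::complex list) (cs::complex list) (ds::complex list) (N::nat).
       length as = p \<longrightarrow> length bs = r \<longrightarrow> length cs = q \<longrightarrow> length ds = s \<longrightarrow>
       q \<ge> p + 1 \<longrightarrow> int s \<ge> int r - 1 \<longrightarrow>
       (\<forall>c\<in>set cs. c \<notin> \<int>) \<longrightarrow> (\<forall>d\<in>set ds. d \<notin> \<int>\<^sub>\<le>\<^sub>0) \<longrightarrow> N > 0 \<longrightarrow>
       (\<lambda>n::nat.
          hypergeom (map (\<lambda>a. a - of_nat n) as @ bs) (map (\<lambda>c. c - of_nat n) cs @ ds) z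
          - (\<Sum>k<N. (\<Prod>a\<leftarrow>as. pochhammer (a - of_nat n) k) / (\<Prod>c\<leftarrow>cs. pochhammer (c - of_nat n) k)
                    * ((\<Prod>b\<leftarrow>bs. pochhammer b k) / (\<Prod>d\<leftarrow>ds. pochhammer d k))
                    * (z ^ k / fact k)))
       \<in> O[at_top](\<lambda>n::nat. of_nat n powi ((int p - int q) * int N)))
    \<and>
    (\<forall>(p::nat) (as::complex list) (cs::complex list) (b::complex) (d::complex) (N::nat).
       length as = p \<longrightarrow> length cs = p \<longrightarrow>
       (\<forall>c\<in>set cs. c \<notin> \<int>\<^sub>\<le>\<^sub>0) \<longrightarrow> b \<notin> \<int> \<longrightarrow> d \<notin> \<int> \<longrightarrow> N > 0 \<longrightarrow>
       (\<lambda>n::nat.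
          hypergeom (as @ [b - of_nat n]) (cs @ [d - of_nat n]) z
          - (\<Sum>k<N. (\<Prod>a\<leftarrow>as. pochhammer a k) / (\<Prod>c\<leftarrow>cs. pochhammer c k)
                    * (pochhammer (d - b) k / pochhammer (d - of_nat n) k)
                    * ((- z) ^ k / fact k)
                    * hypergeom (map (\<lambda>a. a + of_nat k) as) (map (\<lambda>c. c + of_nat k) cs) z))
       \<in> O[at_top](\<lambda>n::nat. of_nat n powi (- int N)))"
proof (intro conjI allI impI)
  fix p q r s N :: nat and as bs cs ds :: "complex list"
  assume len: "length as = p" "length bs = r" "length cs = q" "length ds = s"
    and pq: "q \<ge> p + 1" and rs: "int s \<ge> int r - 1"
    and cs: "\<forall>c\<in>set cs. c \<notin> \<int>" and ds: "\<forall>d\<in>set ds. d \<notin> \<int>\<^sub>\<le>\<^sub>0"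
  have e: "- int ((length cs - length as) * N) = (int p - int q) * int N"
    using pq len by (simp add: of_nat_diff algebra_simps)
  have "length as + 1 \<le> length cs" "length bs \<le> length ds + 1"
    using pq rs len by auto
  from hypergeom_shifted_lower_remainder[OF this cs ds, of z N, unfolded e]
  show "(\<lambda>n::nat.
          hypergeom (map (\<lambda>a. a - of_nat n) as @ bs) (map (\<lambda>c. c - of_nat n) cs @ ds) z
          - (\<Sum>k<N. (\<Prod>a\<leftarrow>as. pochhammer (a - of_nat n) k) / (\<Prod>c\<leftarrow>cs. pochhammer (c - of_nat n) k)
                    * ((\<Prod>b\<leftarrow>bs. pochhammer b k) / (\<Prod>d\<leftarrow>ds. pochhammer d k))
                    * (z ^ k / fact k)))
       \<in> O[at_top](\<lambda>n::nat. of_nat n powi ((int p - int q) * int N))" .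
next
  fix p N :: nat and as cs :: "complex list" and b d :: complex
  assume "length as = p" "length cs = p" and cs: "\<forall>c\<in>set cs. c \<notin> \<int>\<^sub>\<le>\<^sub>0" and d: "d \<notin> \<int>"
  then have "length as = length cs" by simp
  from hypergeom_one_shifted_pair_remainder[OF this cs d]
  show "(\<lambda>n::nat.
          hypergeom (as @ [b - of_nat n]) (cs @ [d - of_nat n]) z
          - (\<Sum>k<N. (\<Prod>a\<leftarrow>as. pochhammer a k) / (\<Prod>c\<leftarrow>cs. pochhammer c k)
                    * (pochhammer (d - b) k / pochhammer (d - of_nat n) k)
                    * ((- z) ^ k / fact k)
                    * hypergeom (map (\<lambda>a. a + of_nat k) as) (map (\<lambda>c. c + of_nat k) cs) z))
       \<in> O[at_top](\<lambda>n::nat. of_nat n powi (- int N))" .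
qed

end
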